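(* Let $A>B\ge 0$ be such that $Ax^2+Bx$ is an integer-valued polynomial, and let $a,b,c$ be distinct positive integers with $\gcd(a,b)=\gcd(a,c)=\gcd(b,c)=1$. For integers $k\ge 1$ and $n\ge 0$, let $\gamma_{a,b,c,A,B}^k(n)$ be defined by $$\frac{1}{(1-q^a)(1-q^b)(1-q^c)}\sum_{j\notin[-k,k-1]}(-1)^{j+k}q^{Aj^2+Bj}=\sum_{n=0}^{\infty}\gamma_{a,b,c,A,B}^k(n)q^n .$$ Write $D=D_{a,b,c}$ and let $\mathcal{T}$ be the operation defined in the context. (1) For all integers $n\ge 0$ and all integers $k\ge 1$ with $k\ge K_{a,b,c,A,B}$, we have $\gamma_{a,b,c,A,B}^k(n)\ge 0$, where $$K_{a,b,c,A,B}=\lceil\mathcal{T}_k\{H_1,H_2,\ldots,H_{13}\}\rceil$$ and $H_1,\ldots,H_{13}$ are the following quadratic functions of the variable $k$: \begin{align*} H_1&=\tfrac{2(A-B)^2k^2}{abc}+\tfrac{(A-B)(2A-2B+a+b+c)k}{abc}+\tfrac{(A-B)(A-B+a+b+c)}{2abc}-2D,\\ H_2&=\tfrac{2(A-B)(A+B)k^2}{abc}+\tfrac{(A-B)(2A+4B+a+b+c)k}{abc}+\tfrac{(A-B)(A+3B+a+b+c)}{2abc}-3D,\\ H_3&=\tfrac{4A(A-B)k^2}{abc}+\tfrac{2(2A+B)(A-B)k}{abc}-\tfrac{(A-B)(A-3B+a+b+c)}{abc}-3D,\\ H_4&=\tfrac{4A(A-B)k^2}{abc}+\tfrac{2(A-B)(2A-B)k}{abc}-\tfrac{(A-B)(A+5B+a+b+c)}{abc}-4D,\\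 H_5&=\tfrac{4A(A-B)k^2}{abc}+\tfrac{2(A-B)(2A-B)k}{abc}-\tfrac{24(A-B)(A+B)+(a+b+c)^2}{8abc}-5D,\\ H_6&=\tfrac{4A(A-B)k^2}{abc}+\tfrac{6(A-B)(2A-B)k}{abc}+\tfrac{(A-B)(A-11B+a+b+c)}{abc}-4D,\\ H_7&=\tfrac{2(A-B)(3A-B)k^2}{abc}+\tfrac{(A-B)(10A-8B+a+b+c)k}{abc}+\tfrac{3(A-B)(A-5B+a+b+c)}{2abc}-6D,\\ H_8&=\tfrac{4A(A-B)k^2}{abc}+\tfrac{6(A-B)(2A+B)k}{abc}+\tfrac{(A-B)(A+13B+a+b+c)}{abc}-4D,\\ H_9&=\tfrac{2(A-B)(3A+B)k^2}{abc}+\tfrac{(A-B)(10A+a+b+c+10B)k}{abc}+\tfrac{3(A-B)(A+7B+a+b+c)}{2abc}-7D,\\ H_{10}&=\tfrac{4A(A-B)k^2}{abc}+\tfrac{2(A-B)(8A+B)k}{abc}+\tfrac{(A-B)(A-15B+a+b+c)}{abc}-4D,\\ H_{11}&=\tfrac{8A(A-B)k^2}{abc}+\tfrac{4(A-B)(4A+B)k}{abc}-\tfrac{2(A-B)(A-7B+a+b+c)}{abc}-7D,\\ H_{12}&=\tfrac{4A(A-B)k^2}{abc}+\tfrac{2(A-B)(8A-B)k}{abc}-\tfrac{(A-B)(A+17B+a+b+c)}{abc}-4D,\\ H_{13}&=\tfrac{8A(A-B)k^2}{abc}+\tfrac{4(A-B)(4A-B)k}{abc}-\tfrac{2(A-B)(A+9B+a+b+c)}{abc}-8D.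 \end{align*} (2) For every integer $k\ge 1$ and all integers $n\ge N_{a,b,c,A,B}^k$, where $$N_{a,b,c,A,B}^k=A\left(k+2L_{a,b,c,A,B}^k\right)^2+B\left(k+2L_{a,b,c,A,B}^k\right),\qquad L_{a,b,c,A,B}^k=\lceil\mathcal{T}_l\{G_1,G_2,\ldots,G_5\}\rceil,$$ we have $\gamma_{a,b,c,A,B}^k(n)\ge 0$, where $G_1,\ldots,G_5$ are the following quadratic functions of the variable $l$ (with $k$ fixed): \begin{align*} G_1&=\tfrac{2(A-B)(2Ak-A-B)l^2}{abc}+\tfrac{(2k+1)(A-B)(2Ak-A-B)l}{abc}-\tfrac{(a+b+c)^2}{8abc}-(4l+1)D,\\ G_2&=\tfrac{4(A-B)(Ak-B)l^2}{abc}+\tfrac{(A-B)(4Ak^2+4Ak-6Bk+A-3B+a+b+c)l}{abc}\\ &\quad+\tfrac{(2k+1)(A-B)(2Ak-2Bk+A-B+a+b+c)}{2abc}-(4l+2)D,\\ G_3&=\tfrac{4(A-B)(Ak+B)l^2}{abc}+\tfrac{(A-B)(4Ak^2+4Ak+6Bk+A+5B+a+b+c)l}{abc}\\ &\quad+\tfrac{(2k+1)(A-B)(2Ak+2Bk+A+3B+a+b+c)}{2abc}-(4l+3)D,\\ G_4&=\tfrac{4(A-B)(Ak+B)l^2}{abc}+\tfrac{(A-B)(4Ak^2+8Ak+2Bk-A+7B-a-b-c)l}{abc}\\ &\quad+\tfrac{(A-B)(4Ak^2+4Ak+2Bk-A+3B-a-b-c)}{abc}-(4l+3)D,\\ G_5&=\tfrac{4(A-B)(Ak-B)l^2}{abc}+\tfrac{(A-B)(4Ak^2+8Ak-2Bk-A-9B-a-b-c)l}{abc}\\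 &\quad+\tfrac{(A-B)(4Ak^2+4Ak-2Bk-A-5B-a-b-c)}{abc}-(4l+4)D. \end{align*}
   Context: Identities are between formal power series in $q$. "Integer-valued polynomial" means that it takes integer values at all integers. For integers $s<t$, $\sum_{j\notin[s,t]}A_j$ denotes $\sum_{j=-\infty}^{s-1}A_j+\sum_{j=t+1}^{\infty}A_j$ (sum over integers $j$ outside $[s,t]$). $\lceil x\rceil$ is the smallest integer $\ge x$. The constant $D_{a,b,c}$: for distinct pairwise coprime positive integers $a,b,c$, define $\alpha(n)$ by $\frac{1}{(1-q^a)(1-q^b)(1-q^c)}=\sum_{n\ge 0}\alpha(n)q^n$ and put $\beta(n)=\alpha(n)-\frac{n^2+(a+b+c)n}{2abc}$ for $n\ge 0$. The sequence $\{\beta(n)\}_{n\ge0}$ is periodic with period $abc$, hence bounded, and $D_{a,b,c}$ is the smallest real number with $|\beta(n)|\le D_{a,b,c}$ for all integers $n\ge 0$. The operations $\mathcal{R}$ and $\mathcal{T}$: for a real quadratic function $G(x)=ux^2+vx+w$ with $u>0$ and $\Delta_G=v^2-4uw$, set $\mathcal{R}_xG(x)=1$ if $\Delta_G<0$, and $\mathcal{R}_xG(x)=\max\left\{1,\frac{-v+\sqrt{\Delta_G}}{2u}\right\}$ if $\Delta_G\ge 0$. For real quadratic functions $G_1,\ldots,G_m$ in $x$ with positive leading coefficients, $\mathcal{T}_x\{G_1(x),\ldots,G_m(x)\}=\max\{\mathcal{R}_xG_1(x),\ldots,\mathcal{R}_xG_m(x)\}$. The subscript of $\mathcal{T}$ indicates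 the variable with respect to which the functions are regarded as quadratics. *)

theory Defs
  imports "HOL-Analysis.Analysis" "HOL-Library.Quadratic_Discriminant"
begin

definition integer_valued :: "real poly \<Rightarrow> bool" where
  "integer_valued p \<longleftrightarrow> (\<forall>x::int. poly p (of_int x) \<in> \<int>)"

definition recip_prod :: "nat \<Rightarrow> nat \<Rightarrow> nat \<Rightarrow> real fps" where
  "recip_prod a b c = 1 / ((1 - fps_X ^ a) * (1 - fps_X ^ b) * (1 - fps_X ^ c))"

definition alpha :: "nat \<Rightarrow> nat \<Rightarrow> nat \<Rightarrow> nat \<Rightarrow> real" where
  "alpha a b c n = fps_nth (recip_prod a b c) n"

definition beta :: "nat \<Rightarrow> nat \<Rightarrow> nat \<Rightarrow> nat \<Rightarrow> real" where
  "beta a b c n =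
     alpha a b c n - (real n ^ 2 + real (a + b + c) * real n) / (2 * real (a * b * c))"

(* The minimum exists for distinct pairwise coprime positive a, b, c,
   since beta is then periodic, hence bounded. *)
definition D_const :: "nat \<Rightarrow> nat \<Rightarrow> nat \<Rightarrow> real" where
  "D_const a b c = (LEAST D::real. \<forall>n. \<bar>beta a b c n\<bar> \<le> D)"

(* The sum of f j over all integers j outside [s, t] (for s < t): the first series runs over
   j = s - 1, s - 2, ..., the second over j = t + 1, t + 2, ....  For formal power series the
   limits are taken in the metric of Formal_Power_Series, i.e. coefficientwise. *)
definition sum_outside :: "int \<Rightarrow> int \<Rightarrow> (int \<Rightarrow> 'a::{topological_space, comm_monoid_add}) \<Rightarrow> 'a" where
  "sum_outside s t f = (\<Sum>i. f (s - 1 - int i)) + (\<Sum>i. f (t + 1 + int i))"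

(* When A x^2 + B x is integer-valued and A > B >= 0, its values at integers are natural numbers,
   so nat and floor only change the type of the exponent. *)
definition gamma_coeff :: "nat \<Rightarrow> nat \<Rightarrow> nat \<Rightarrow> real \<Rightarrow> real \<Rightarrow> int \<Rightarrow> nat \<Rightarrow> real" where
  "gamma_coeff a b c A B k n =
     fps_nth (recip_prod a b c *
       sum_outside (- k) (k - 1)
         (\<lambda>j. fps_const ((- 1) powi (j + k)) * fps_X ^ nat \<lfloor>A * of_int j ^ 2 + B * of_int j\<rfloor>)) n"

(* Quadratic functions are represented as polynomials; quad u v w is u x^2 + v x + w. *)
definition quad :: "real \<Rightarrow> real \<Rightarrow> real \<Rightarrow> real poly" where
  "quad u v w = [:w, v, u:]"

definition R_op :: "real poly \<Rightarrow> real" where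
  "R_op G = (let u = coeff G 2; v = coeff G 1; w = coeff G 0 in
     if discrim u v w < 0 then 1
     else max 1 ((- v + sqrt (discrim u v w)) / (2 * u)))"

definition T_op :: "real poly set \<Rightarrow> real" where
  "T_op Gs = Max (R_op ` Gs)"

definition H_quadratics :: "nat \<Rightarrow> nat \<Rightarrow> nat \<Rightarrow> real \<Rightarrow> real \<Rightarrow> real poly set" where
  "H_quadratics a b c A B =
    (let p = real (a * b * c); s = real (a + b + c); D = D_const a b c in
     {quad (2 * (A - B)^2 / p)
           ((A - B) * (2 * A - 2 * B + s) / p)
           ((A - B) * (A - B + s) / (2 * p) - 2 * D),
      quad (2 * (A - B) * (A + B) / p)
           ((A - B) * (2 * A + 4 * B + s) / p)
           ((A - B) * (A + 3 * B + s) / (2 * p) - 3 * D),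
      quad (4 * A * (A - B) / p)
           (2 * (2 * A + B) * (A - B) / p)
           (- ((A - B) * (A - 3 * B + s) / p) - 3 * D),
      quad (4 * A * (A - B) / p)
           (2 * (A - B) * (2 * A - B) / p)
           (- ((A - B) * (A + 5 * B + s) / p) - 4 * D),
      quad (4 * A * (A - B) / p)
           (2 * (A - B) * (2 * A - B) / p)
           (- ((24 * (A - B) * (A + B) + s^2) / (8 * p)) - 5 * D),
      quad (4 * A * (A - B) / p)
           (6 * (A - B) * (2 * A - B) / p)
           ((A - B) * (A - 11 * B + s) / p - 4 * D),
      quad (2 * (A - B) * (3 * A - B) / p)
           ((A - B) * (10 * A - 8 * B + s) / p)
           (3 * (A - B) * (A - 5 * B + s) / (2 * p) - 6 * D),
      quad (4 * A * (A - B) / p)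
           (6 * (A - B) * (2 * A + B) / p)
           ((A - B) * (A + 13 * B + s) / p - 4 * D),
      quad (2 * (A - B) * (3 * A + B) / p)
           ((A - B) * (10 * A + s + 10 * B) / p)
           (3 * (A - B) * (A + 7 * B + s) / (2 * p) - 7 * D),
      quad (4 * A * (A - B) / p)
           (2 * (A - B) * (8 * A + B) / p)
           ((A - B) * (A - 15 * B + s) / p - 4 * D),
      quad (8 * A * (A - B) / p)
           (4 * (A - B) * (4 * A + B) / p)
           (- (2 * (A - B) * (A - 7 * B + s) / p) - 7 * D),
      quad (4 * A * (A - B) / p)
           (2 * (A - B) * (8 * A - B) / p)
           (- ((A - B) * (A + 17 * B + s) / p) - 4 * D),
      quad (8 * A * (A - B) / p)
           (4 * (A - B) * (4 * A - B) / p)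
           (- (2 * (A - B) * (A + 9 * B + s) / p) - 8 * D)})"

definition K_bound :: "nat \<Rightarrow> nat \<Rightarrow> nat \<Rightarrow> real \<Rightarrow> real \<Rightarrow> int" where
  "K_bound a b c A B = \<lceil>T_op (H_quadratics a b c A B)\<rceil>"

(* In the variable l, smult D [:m, 4:] is the polynomial (4 l + m) D. *)
definition G_quadratics :: "nat \<Rightarrow> nat \<Rightarrow> nat \<Rightarrow> real \<Rightarrow> real \<Rightarrow> int \<Rightarrow> real poly set" where
  "G_quadratics a b c A B k' =
    (let p = real (a * b * c); s = real (a + b + c); D = D_const a b c; k = real_of_int k' in
     {quad (2 * (A - B) * (2 * A * k - A - B) / p)
           ((2 * k + 1) * (A - B) * (2 * A * k - A - B) / p)
           (- (s^2 / (8 * p))) - smult D [:1, 4:],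
      quad (4 * (A - B) * (A * k - B) / p)
           ((A - B) * (4 * A * k^2 + 4 * A * k - 6 * B * k + A - 3 * B + s) / p)
           ((2 * k + 1) * (A - B) * (2 * A * k - 2 * B * k + A - B + s) / (2 * p))
         - smult D [:2, 4:],
      quad (4 * (A - B) * (A * k + B) / p)
           ((A - B) * (4 * A * k^2 + 4 * A * k + 6 * B * k + A + 5 * B + s) / p)
           ((2 * k + 1) * (A - B) * (2 * A * k + 2 * B * k + A + 3 * B + s) / (2 * p))
         - smult D [:3, 4:],
      quad (4 * (A - B) * (A * k + B) / p)
           ((A - B) * (4 * A * k^2 + 8 * A * k + 2 * B * k - A + 7 * B - s) / p)
           ((A - B) * (4 * A * k^2 + 4 * A * k + 2 * B * k - A + 3 * B - s) / p)
         - smult D [:3, 4:],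
      quad (4 * (A - B) * (A * k - B) / p)
           ((A - B) * (4 * A * k^2 + 8 * A * k - 2 * B * k - A - 9 * B - s) / p)
           ((A - B) * (4 * A * k^2 + 4 * A * k - 2 * B * k - A - 5 * B - s) / p)
         - smult D [:4, 4:]})"

definition L_bound :: "nat \<Rightarrow> nat \<Rightarrow> nat \<Rightarrow> real \<Rightarrow> real \<Rightarrow> int \<Rightarrow> int" where
  "L_bound a b c A B k = \<lceil>T_op (G_quadratics a b c A B k)\<rceil>"

definition N_bound :: "nat \<Rightarrow> nat \<Rightarrow> nat \<Rightarrow> real \<Rightarrow> real \<Rightarrow> int \<Rightarrow> real" where
  "N_bound a b c A B k =
     (let m = real_of_int (k + 2 * L_bound a b c A B k) in A * m ^ 2 + B * m)"

end

theory Submission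
  imports Defs "HOL-Computational_Algebra.Polynomial_Factorial" "HOL-Computational_Algebra.Field_as_Ring"
begin

text \<open>
  Up to a periodic error bounded by \<open>D\<close>, \<open>\<alpha>(n)\<close> is the quadratic \<open>(n\<^sup>2 + (a+b+c) n) / (2abc)\<close>.
  With \<open>e m = A m\<^sup>2 + B m\<close> and \<open>f m = A m\<^sup>2 - B m\<close>, the exponents in the truncated sum are ordered
  \<open>e k < f (k+1) \<le> e (k+1) < f (k+2) \<le> \<dots>\<close> and their signs repeat as \<open>+ - - +\<close>. If \<open>n\<close> lies
  between \<open>e (k+2l)\<close> and \<open>e (k+2l+2)\<close>, then \<open>l\<close> complete blocks of four terms and between one and
  four further terms contribute, so \<open>\<gamma>(n)\<close> is at least an explicit polynomial in \<open>n\<close> minus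
  \<open>(4l+1)D, \<dots>, (4l+4)D\<close>. This polynomial is convex for one extra term, increasing for two,
  concave for three and decreasing for four, hence minimised at its vertex or at the ends of the range
  of \<open>n\<close>; the minima are \<open>G\<^sub>1, \<dots>, G\<^sub>5\<close>. For part (1), the functions \<open>H\<^sub>i\<close> are the values of the
  \<open>G\<^sub>j\<close> at \<open>l = 0, 1\<close> and their \<open>l\<close>-derivatives at \<open>l = 1\<close>.
\<close>

section \<open>Periodicity of \<open>\<beta>\<close>\<close>

text \<open>The q-integer \<open>[n]\<close>, characterised by \<open>(1 - X) [n] = 1 - X^n\<close>;
  divisibility and coprimality pass from integers to these polynomials.\<close>

definition geom :: "nat \<Rightarrow> real poly" where
  "geom n = (\<Sum>i<n. [:0, 1:] ^ i)"

lemma one_minus_X_times_geom: "(1 - [:0, 1:]) * geom n = 1 - [:0, 1:] ^ n"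
  unfolding geom_def by (simp add: one_diff_power_eq)

lemma geom_dvd_geom_mult: "geom m dvd geom (m * n)"
proof -
  have nz: "(1 - [:0, 1:]) \<noteq> (0::real poly)" by (simp add: one_pCons)
  have "(1 - [:0, 1:]) * geom (m * n) = (1 - [:0, 1:]) * (geom m * (\<Sum>i<n. ([:0, 1:] ^ m) ^ i))"
    unfolding mult.assoc[symmetric] one_minus_X_times_geom
    by (simp add: power_mult one_diff_power_eq)
  with nz have "geom (m * n) = geom m * (\<Sum>i<n. ([:0, 1:] ^ m) ^ i)"
    using mult_left_cancel by blast
  then show ?thesis by simp
qed

text \<open>Bezout's \<open>m x = n y + 1\<close> gives \<open>[m x] = 1 + X [n y]\<close>, so a
  common divisor of \<open>[m]\<close> and \<open>[n]\<close> divides 1.\<close>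

lemma coprime_geom:
  assumes "coprime m n" "m > 0"
  shows "coprime (geom m) (geom n)"
proof -
  obtain x y where xy: "m * x = n * y + 1"
    using bezout_nat[of m n] assms by auto
  have "geom (n * y + 1) = 1 + [:0, 1:] * geom (n * y)"
    by (simp only: geom_def Suc_eq_plus1[symmetric] sum.lessThan_Suc_shift sum_distrib_left)
       simp
  then have eq: "geom (m * x) = 1 + [:0, 1:] * geom (n * y)"
    using xy by simp
  show ?thesis
  proof (rule coprimeI)
    fix d assume d: "d dvd geom m" "d dvd geom n"
    have "d dvd geom (m * x)" "d dvd [:0, 1:] * geom (n * y)"
      using d geom_dvd_geom_mult dvd_trans dvd_mult by blast+
    then have "d dvd geom (m * x) - [:0, 1:] * geom (n * y)" by (rule dvd_diff)
    then show "is_unit d" by (simp add: eq)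
  qed
qed

lemma poly_geom_1 [simp]: "poly (geom n) 1 = real n"
  by (simp add: geom_def poly_sum)

lemma poly_pderiv_geom_1: "poly (pderiv (geom n)) 1 = real n * (real n - 1) / 2"
proof (induction n)
  case (Suc n)
  have "poly (pderiv ([:0, 1:] ^ n)) 1 = real n"
    by (induction n) (simp_all add: pderiv_pCons)
  then show ?case using Suc by (simp add: geom_def pderiv_add field_simps)
qed (simp add: geom_def)

lemma coeff_geom: "coeff (geom n) i = (if i < n then 1 else 0)"
proof -
  have "geom n = (\<Sum>i<n. monom 1 i)"
    unfolding geom_def by (simp add: monom_altdef)
  then show ?thesis by (simp add: coeff_sum)
qed

lemma degree_geom: "n > 0 \<Longrightarrow> degree (geom n) = n - 1"
  by (intro antisym degree_le le_degree) (auto simp: coeff_geom)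

lemma fps_of_poly_geom: "(1 - fps_X) * fps_of_poly (geom n) = 1 - fps_X ^ n"
proof -
  have "fps_of_poly ((1 - [:0, 1:]) * geom n) = fps_of_poly (1 - [:0, 1:] ^ n :: real poly)"
    by (simp add: one_minus_X_times_geom)
  then show ?thesis
    by (simp add: fps_of_poly_mult fps_of_poly_diff fps_of_poly_power)
qed

lemma recip_prod_mult:
  assumes "a > 0" "b > 0" "c > 0"
  shows "recip_prod a b c * ((1 - fps_X ^ a) * (1 - fps_X ^ b) * (1 - fps_X ^ c)) = 1"
proof -
  have "fps_nth ((1 - fps_X ^ a) * (1 - fps_X ^ b) * (1 - fps_X ^ c)) 0 \<noteq> (0::real)"
    using assms by simp
  then show ?thesis
    unfolding recip_prod_def by (simp add: fps_divide_unit inverse_mult_eq_1)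
qed

text \<open>
  Coprimality makes \<open>T = [abc] / ([a][b][c])\<close> a polynomial, where \<open>[n] = 1 + X + \<dots> + X\<^sup>n\<^sup>-\<^sup>1\<close>, and
  \<open>\<alpha>(n + abc) - \<alpha>(n)\<close> is the coefficient of \<open>X\<^sup>n\<^sup>+\<^sup>a\<^sup>b\<^sup>c\<close> in \<open>T / (1 - X)\<^sup>2\<close>. It depends only on
  \<open>T(1)\<close> and \<open>T'(1)\<close>, as the degree of \<open>T\<close> is at most \<open>abc\<close>.
\<close>
lemma alpha_shift:
  assumes pos: "a > 0" "b > 0" "c > 0"
    and cop: "coprime a b" "coprime a c" "coprime b c"
  shows "alpha a b c (n + a * b * c) = alpha a b c n + real n + real (a * b * c + a + b + c) / 2"
proof -
  define p where "p = a * b * c"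
  have ppos: "p > 0" using pos by (simp add: p_def)
  have "geom a dvd geom p" "geom b dvd geom p" "geom c dvd geom p"
    using geom_dvd_geom_mult[of a "b * c"] geom_dvd_geom_mult[of b "a * c"]
      geom_dvd_geom_mult[of c "a * b"] by (simp_all add: p_def mult_ac)
  then have "geom a * geom b * geom c dvd geom p"
    using coprime_geom pos cop by (auto intro!: divides_mult)
  then obtain T where T: "geom p = geom a * geom b * geom c * T" by (rule dvdE)
  have T1: "poly T 1 = 1"
    using arg_cong[OF T, of "\<lambda>q. poly q 1"] pos by (simp add: p_def)
  \<comment> \<open>Differentiate the factorisation of \<open>[p]\<close> at 1, where each factor
    \<open>[n]\<close> has logarithmic derivative \<open>(n - 1) / 2\<close>.\<close>
  have T2: "poly (pderiv T) 1 = (real p - real (a + b + c)) / 2 + 1"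
  proof -
    have "real p * (real p - 1) / 2 = poly (pderiv (geom a * geom b * geom c * T)) 1"
      by (simp add: T[symmetric] poly_pderiv_geom_1)
    also have "\<dots> = real p * (poly (pderiv T) 1 + (real a - 1) / 2 + (real b - 1) / 2 + (real c - 1) / 2)"
      using T1 by (simp add: pderiv_mult poly_pderiv_geom_1 p_def field_simps)
    finally have "real p * ((real p - 1) / 2) =
        real p * (poly (pderiv T) 1 + (real a - 1) / 2 + (real b - 1) / 2 + (real c - 1) / 2)"
      by simp
    then have "(real p - 1) / 2 = poly (pderiv T) 1 + (real a - 1) / 2 + (real b - 1) / 2 + (real c - 1) / 2"
      using ppos by (simp only: mult_cancel_left) simp
    then show ?thesis by (simp add: field_simps)
  qed
  have Tnz: "geom a \<noteq> 0" "geom b \<noteq> 0" "geom c \<noteq> 0" "T \<noteq> 0"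
    using poly_geom_1 pos T1 by (metis of_nat_eq_0_iff poly_0 less_numeral_extra(3) zero_neq_one)+
  \<comment> \<open>Comparing degrees gives \<open>degree T = p + 2 - (a + b + c)\<close>. Hence the
    convolution below sees all coefficients of \<open>T\<close>, and \<open>n + p - i\<close> is
    never truncated.\<close>
  have degT: "degree T \<le> p"
    using arg_cong[OF T, of degree] Tnz ppos by (simp add: degree_mult_eq degree_geom)
  define F where "F = recip_prod a b c"
  \<comment> \<open>\<open>(1 - X)^3 [a] [b] [c]\<close> is the denominator of \<open>F\<close>, so
    only \<open>T\<close> survives.\<close>
  have "F * (1 - fps_X ^ p) * (1 - fps_X)^2
      = F * ((1 - fps_X)^3 * fps_of_poly (geom p))"
    by (simp add: fps_of_poly_geom[symmetric] power2_eq_square power3_eq_cube mult_ac)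
  also have "\<dots> = F * ((1 - fps_X ^ a) * (1 - fps_X ^ b) * (1 - fps_X ^ c)) * fps_of_poly T"
    unfolding T fps_of_poly_mult
    by (simp add: fps_of_poly_geom[symmetric] power2_eq_square power3_eq_cube mult_ac)
  also have "\<dots> = fps_of_poly T"
    using recip_prod_mult[OF pos] by (simp add: F_def)
  finally have "F * (1 - fps_X ^ p) * (1 - fps_X)^2 * inverse ((1 - fps_X)^2) = fps_of_poly T * inverse ((1 - fps_X)^2)"
    by simp
  then have F: "F * (1 - fps_X ^ p) = fps_of_poly T * inverse ((1 - fps_X)^2)"
    by (simp add: mult.assoc inverse_mult_eq_1')
  have "inverse ((1 - fps_X)^2) = Abs_fps (\<lambda>n. of_nat (n+1) :: real)"
    using fps_one_over_one_minus_fps_X_squared[where 'a = real] by simp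
  then have "fps_nth (F * (1 - fps_X ^ p)) (n + p) = (\<Sum>i\<le>n + p. coeff T i * real (n + p - i + 1))"
    unfolding F by (simp add: fps_mult_nth atMost_atLeast0)
  also have "\<dots> = (\<Sum>i\<le>degree T. coeff T i * real (n + p - i + 1))"
    using degT by (intro sum.mono_neutral_right) (auto simp: coeff_eq_0 not_le)
  also have "\<dots> = (\<Sum>i\<le>degree T. real (n + p + 1) * coeff T i - real i * coeff T i)"
    using degT by (intro sum.cong) (auto simp: algebra_simps of_nat_diff)
  also have "\<dots> = real (n + p + 1) * poly T 1 - poly (pderiv T) 1"
  proof -
    have 1: "poly T 1 = (\<Sum>i\<le>degree T. coeff T i)"
      by (simp add: poly_altdef)
    have "poly (pderiv T) 1 = (\<Sum>i<degree T. real (Suc i) * coeff T (Suc i))"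
    proof (cases "degree T")
      case 0
      then have "pderiv T = 0" by (simp add: pderiv_eq_0_iff)
      then show ?thesis using 0 by simp
    next
      case (Suc d)
      then show ?thesis
        by (simp add: poly_altdef degree_pderiv coeff_pderiv lessThan_Suc_atMost)
    qed
    also have "\<dots> = (\<Sum>i\<le>degree T. real i * coeff T i)"
      by (simp add: sum.atMost_shift)
    finally show ?thesis by (simp add: 1 sum_subtractf sum_distrib_left)
  qed
  finally have "fps_nth (F * (1 - fps_X ^ p)) (n + p) = real n + real (p + (a + b + c)) / 2"
    by (simp add: T1 T2 field_simps)
  moreover have "fps_nth (F * (1 - fps_X ^ p)) (n + p) = alpha a b c (n + p) - alpha a b c n"
    by (simp add: right_diff_distrib fps_X_power_mult_right_nth alpha_def F_def)
  ultimately show ?thesis by (simp add: p_def add_ac)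
qed

text \<open>Over one period the quadratic grows by exactly \<open>n + (abc + a + b + c) / 2\<close>,
  which is the increment of \<open>alpha\<close>.\<close>

lemma beta_periodic:
  assumes pos: "a > 0" "b > 0" "c > 0"
    and cop: "coprime a b" "coprime a c" "coprime b c"
  shows "beta a b c (n + a * b * c) = beta a b c n"
proof -
  have "real (a * b * c) > 0" using pos by simp
  then show ?thesis
    unfolding beta_def alpha_shift[OF assms] of_nat_add
    by (simp add: divide_simps power2_eq_square del: of_nat_mult) (simp add: algebra_simps)
qed

text \<open>By periodicity the maximum over one period bounds \<open>beta\<close> everywhere; being
  attained, it is the least bound, so the minimum in \<open>D_const\<close> exists.\<close>

lemma abs_beta_le_D_const:
  assumes pos: "a > 0" "b > 0" "c > 0"
    and cop: "coprime a b" "coprime a c" "coprime b c"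
  shows "\<bar>beta a b c n\<bar> \<le> D_const a b c"
proof -
  define p where "p = a * b * c"
  have ppos: "p > 0" using pos by (simp add: p_def)
  define M where "M = Max ((\<lambda>n. \<bar>beta a b c n\<bar>) ` {..<p})"
  have shift: "beta a b c (r + q * p) = beta a b c r" for r q
  proof (induction q)
    case (Suc q)
    have "r + Suc q * p = (r + q * p) + a * b * c" by (simp add: p_def)
    then show ?case using beta_periodic[OF assms, of "r + q * p"] Suc by (simp only:)
  qed simp
  have ub: "\<bar>beta a b c m\<bar> \<le> M" for m
  proof -
    have "beta a b c m = beta a b c (m mod p)"
      using shift[of "m mod p" "m div p"] by simp
    then show ?thesis using ppos by (auto simp: M_def intro!: Max_ge)
  qed
  have "M \<in> (\<lambda>n. \<bar>beta a b c n\<bar>) ` {..<p}"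
    unfolding M_def using ppos by (intro Max_in) auto
  then have "D_const a b c = M"
    unfolding D_const_def using ub by (intro Least_equality) auto
  then show ?thesis using ub by simp
qed

text \<open>The series is the product of the indicator series of the multiples of \<open>a\<close>,
  \<open>b\<close> and \<open>c\<close>. This settles the range where only the first exponent
  contributes; there the quadratic estimate \<open>G1 0\<close> is negative.\<close>

lemma alpha_nonneg:
  assumes pos: "a > 0" "b > 0" "c > 0"
  shows "alpha a b c n \<ge> 0"
proof -
  define E where "E d = Abs_fps (\<lambda>n. if d dvd n then 1 else 0 :: real)" for d :: nat
  have E: "(1 - fps_X ^ d) * E d = 1" if "d > 0" for d
    using that by (intro fps_ext)
      (auto simp: left_diff_distrib fps_X_power_mult_nth E_def dvd_minus_self)
  define F where "F = recip_prod a b c"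
  have "F = F * (((1 - fps_X ^ a) * E a) * ((1 - fps_X ^ b) * E b) * ((1 - fps_X ^ c) * E c))"
    using pos by (simp add: E)
  also have "\<dots> = F * ((1 - fps_X ^ a) * (1 - fps_X ^ b) * (1 - fps_X ^ c)) * (E a * E b * E c)"
    by (simp add: mult_ac)
  also have "\<dots> = E a * E b * E c"
    using recip_prod_mult[OF pos] by (simp add: F_def)
  finally show ?thesis
    by (simp add: alpha_def F_def fps_mult_nth E_def sum_nonneg)
qed

section \<open>Quadratic functions and the operation \<open>\<T>\<close>\<close>

text \<open>Completing the square gives \<open>4 u G(x) = (2 u x + v)^2 - discrim u v w\<close>;
  beyond the larger root, \<open>2 u x + v\<close> is at least the square root of the
  discriminant.\<close>

lemma poly_nonneg_of_ge_R_op: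
  assumes deg: "degree G \<le> 2" and u: "coeff G 2 > 0" and x: "x \<ge> R_op G"
  shows "poly G x \<ge> 0"
proof -
  define u v w where "u = coeff G 2" and "v = coeff G 1" and "w = coeff G 0"
  have upos: "u > 0" using u by (simp add: u_def)
  have "degree G = 2" using deg u le_degree[of G 2] by simp
  then have G: "poly G x = u * x^2 + v * x + w"
    by (simp add: poly_altdef u_def v_def w_def numeral_2_eq_2)
  have sq: "4 * u * poly G x = (2 * u * x + v)^2 - discrim u v w"
    by (simp add: G discrim_def power2_eq_square algebra_simps)
  have "discrim u v w \<le> (2 * u * x + v)^2"
  proof (cases "discrim u v w < 0")
    case False
    then have "x \<ge> (- v + sqrt (discrim u v w)) / (2 * u)"
      using x by (simp add: R_op_def u_def v_def w_def Let_def)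
    then have "2 * u * x + v \<ge> sqrt (discrim u v w)"
      using upos by (simp add: field_simps)
    then have "(sqrt (discrim u v w))^2 \<le> (2 * u * x + v)^2"
      using False by (intro power_mono) auto
    then show ?thesis using False by simp
  qed (use zero_le_power2[of "2 * u * x + v"] in linarith)
  then have "0 \<le> 4 * u * poly G x" using sq by simp
  then show ?thesis using upos by (simp add: zero_le_mult_iff)
qed

lemma poly_nonneg_of_ge_T_op:
  assumes "finite Gs" "x \<ge> T_op Gs" "\<forall>G\<in>Gs. degree G \<le> 2 \<and> coeff G 2 > 0"
  shows "\<forall>G\<in>Gs. poly G x \<ge> 0"
proof
  fix G assume G: "G \<in> Gs"
  then have "R_op G \<le> T_op Gs"
    using assms(1) by (simp add: T_op_def)
  then show "poly G x \<ge> 0"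
    using G assms by (intro poly_nonneg_of_ge_R_op) auto
qed

lemma T_op_ge_1:
  assumes "finite Gs" "Gs \<noteq> {}"
  shows "T_op Gs \<ge> 1"
proof -
  obtain G where G: "G \<in> Gs" using assms by auto
  have "1 \<le> R_op G" by (simp add: R_op_def Let_def)
  also have "\<dots> \<le> T_op Gs" using G assms(1) by (simp add: T_op_def)
  finally show ?thesis .
qed

text \<open>Taylor expansion at 1: the hypotheses concern the value and the derivative
  there.\<close>

lemma quadratic_nonneg_right_of_1:
  fixes u v w x :: real
  assumes "u \<ge> 0" "u + v + w \<ge> 0" "2 * u + v \<ge> 0" "x \<ge> 1"
  shows "u * x^2 + v * x + w \<ge> 0"
proof -
  have "u * x^2 + v * x + w = (u + v + w) + (2 * u + v) * (x - 1) + u * (x - 1)^2"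
    by (simp add: power2_eq_square algebra_simps)
  moreover have "(2 * u + v) * (x - 1) \<ge> 0" "u * (x - 1)^2 \<ge> 0" using assms by simp_all
  ultimately show ?thesis using assms(2) by linarith
qed

text \<open>The value is that of the chord between the endpoints plus
  \<open>w (x - u) (v - x)\<close>.\<close>

lemma concave_quadratic_ge:
  fixes q :: "real \<Rightarrow> real"
  assumes q: "\<And>x. q x = - (w * x^2) + \<beta> * x + \<gamma>" and "w \<ge> 0"
    and "u \<le> x" "x < v" "q u \<ge> d" "q v \<ge> d"
  shows "q x \<ge> d"
proof -
  have "(v - u) * (q x - d) = (v - x) * (q u - d) + (x - u) * (q v - d) + w * (x - u) * (v - x) * (v - u)"
    unfolding q by (simp add: power2_eq_square algebra_simps)
  also have "\<dots> \<ge> 0" using assms(2-) by simp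
  finally show ?thesis using assms(3,4) by (simp add: zero_le_mult_iff)
qed

section \<open>The coefficients of the truncated sum\<close>

text \<open>Since \<open>i \<le> E i\<close>, terms with \<open>i > n\<close> do not reach
  coefficient \<open>n\<close>; the partial sums stabilise in each coefficient and therefore
  converge.\<close>

lemma fps_nth_suminf_monomials:
  fixes s :: "nat \<Rightarrow> real"
  assumes E: "\<And>i. i \<le> E i" and M: "n < M"
  shows "fps_nth (\<Sum>i. fps_const (s i) * fps_X ^ E i) n =
    fps_nth (\<Sum>i<M. fps_const (s i) * fps_X ^ E i) n"
proof -
  define f where "f i = fps_const (s i) * fps_X ^ E i" for i
  define S where "S = Abs_fps (\<lambda>n. fps_nth (\<Sum>i<Suc n. f i) n)"
  have S: "fps_nth (\<Sum>i<m. f i) n = fps_nth S n" if "n < m" for m n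
  proof -
    have "fps_nth (f i) n = 0" if "n < i" for i
      using that E[of i] by (auto simp: f_def)
    then show ?thesis
      unfolding S_def fps_sum_nth fps_nth_Abs_fps
      using \<open>n < m\<close> by (intro sum.mono_neutral_right) auto
  qed
  have "f sums S"
    unfolding sums_def
  proof (rule tendsto_fpsI)
    show "eventually (\<lambda>m. fps_nth (\<Sum>i<m. f i) n = fps_nth S n) sequentially" for n
      using S by (intro eventually_sequentiallyI[of "Suc n"]) auto
  qed
  then have "(\<Sum>i. fps_const (s i) * fps_X ^ E i) = S"
    by (simp add: sums_iff f_def[abs_def])
  then show ?thesis
    using S[OF M] by (simp add: f_def)
qed

lemma fps_mult_nth_cong:
  assumes "\<And>i. i \<le> n \<Longrightarrow> fps_nth f i = fps_nth g i"
  shows "fps_nth (h * f) n = fps_nth (h * g) n"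
  using assms by (auto simp: fps_mult_nth intro!: sum.cong)

section \<open>The setting and the interlacing of the exponents\<close>

locale truncated_series =
  fixes A B :: real and a b c :: nat and k :: int
  assumes AB: "A > B" "B \<ge> 0"
    and integral: "integer_valued [:0, B, A:]"
    and pos: "a > 0" "b > 0" "c > 0"
    and cop: "coprime a b" "coprime a c" "coprime b c"
    and k: "k \<ge> 1"
begin

definition p :: real where "p = real (a * b * c)"
text \<open>The leading coefficient of the main term; it keeps the identities below free of division
  by \<open>abc\<close>.\<close>

definition w :: real where "w = 1 / (2 * p)"
definition s :: real where "s = real (a + b + c)"
definition D :: real where "D = D_const a b c"
definition r :: real where "r = real_of_int k"

lemma p_pos: "p > 0" using pos by (simp add: p_def)
lemma w_pos: "w > 0" using p_pos by (simp add: w_def)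
lemma s_pos: "s > 0" using pos by (simp add: s_def)
lemma r_ge_1: "r \<ge> 1" using k by (simp add: r_def)

lemma D_nonneg: "D \<ge> 0"
  unfolding D_def using abs_beta_le_D_const[OF pos cop, of 0] by linarith

lemma divide_p: "x / p = 2 * w * x" "x / (2 * p) = w * x" "x / (8 * p) = w * x / 4"
  by (simp_all add: w_def)

definition alpha_main :: "real \<Rightarrow> real" where "alpha_main x = w * (x^2 + s * x)"

lemma alpha_bounds:
  assumes "m \<le> n"
  shows "alpha a b c (n - m) \<ge> alpha_main (real n - real m) - D"
    "alpha a b c (n - m) \<le> alpha_main (real n - real m) + D"
proof -
  have "beta a b c (n - m) = alpha a b c (n - m) - alpha_main (real n - real m)"
    using assms by (simp add: beta_def alpha_main_def w_def p_def s_def of_nat_diff)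
  then show "alpha a b c (n - m) \<ge> alpha_main (real n - real m) - D"
    "alpha a b c (n - m) \<le> alpha_main (real n - real m) + D"
    using abs_beta_le_D_const[OF pos cop, of "n - m"] by (simp_all add: D_def abs_le_iff)
qed

text \<open>The functions \<open>e\<close> and \<open>f\<close> of the introduction, taken at real
  arguments so that statements about them become polynomial identities.\<close>

definition qplus :: "real \<Rightarrow> real" where "qplus x = A * x^2 + B * x"
definition qminus :: "real \<Rightarrow> real" where "qminus x = A * x^2 - B * x"

definition expo :: "int \<Rightarrow> nat" where "expo j = nat \<lfloor>A * of_int j ^ 2 + B * of_int j\<rfloor>"

text \<open>Integrality is the hypothesis on \<open>A x^2 + B x\<close>; for
  \<open>j \<le> -1\<close> nonnegativity follows from \<open>A j + B \<le> B - A < 0\<close>. So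
  \<open>nat\<close> and the floor lose nothing.\<close>

lemma real_expo: "real (expo j) = qplus (of_int j)"
proof -
  have "poly [:0, B, A:] (of_int j) \<in> \<int>"
    using integral by (simp add: integer_valued_def)
  then have int: "qplus (of_int j) \<in> \<int>"
    by (simp add: qplus_def power2_eq_square algebra_simps)
  have "qplus (of_int j) \<ge> 0"
  proof (cases "j \<ge> 0")
    case True then show ?thesis using AB by (simp add: qplus_def)
  next
    case False
    then have "A * of_int j + B \<le> 0"
      using AB mult_left_mono[of "of_int j" "-1" A] by simp
    then have "of_int j * (A * of_int j + B) \<ge> 0"
      using False by (intro mult_nonpos_nonpos) auto
    then show ?thesis by (simp add: qplus_def power2_eq_square algebra_simps)
  qed
  then show ?thesis using int by (simp add: expo_def qplus_def[symmetric])
qed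

text \<open>The two tails of the sum are \<open>j = k + i\<close> and \<open>j = -k - 1 - i\<close>.
  Equal \<open>i\<close> give opposite signs, whence the pairing below.\<close>

definition plus_exp :: "nat \<Rightarrow> nat" where "plus_exp i = expo (k + int i)"
definition minus_exp :: "nat \<Rightarrow> nat" where "minus_exp i = expo (- k - 1 - int i)"

lemma real_plus_exp: "real (plus_exp i) = qplus (r + real i)"
  by (simp add: plus_exp_def real_expo r_def)

lemma real_minus_exp: "real (minus_exp i) = qminus (r + real i + 1)"
  by (simp add: minus_exp_def real_expo r_def qplus_def qminus_def power2_eq_square algebra_simps)

lemma plus_exp_less_minus_exp: "plus_exp i < minus_exp i"
proof -
  have "real (minus_exp i) - real (plus_exp i) = (A - B) * (2 * (r + real i) + 1)"
    by (simp add: real_plus_exp real_minus_exp qplus_def qminus_def power2_eq_square algebra_simps)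
  also have "\<dots> > 0" using AB r_ge_1 by simp
  finally show ?thesis by simp
qed

text \<open>The gap is \<open>2 B (k + i + 1)\<close>, which vanishes for \<open>B = 0\<close>;
  hence only a weak inequality.\<close>

lemma minus_exp_le_plus_exp_Suc: "minus_exp i \<le> plus_exp (Suc i)"
proof -
  have "real (plus_exp (Suc i)) - real (minus_exp i) = 2 * B * (r + real i + 1)"
    by (simp add: real_plus_exp real_minus_exp qplus_def qminus_def power2_eq_square algebra_simps)
  also have "\<dots> \<ge> 0" using AB r_ge_1 by simp
  finally show ?thesis by simp
qed

lemma strict_mono_plus_exp: "strict_mono plus_exp"
  using plus_exp_less_minus_exp minus_exp_le_plus_exp_Suc by (intro strict_mono_Suc_iff[THEN iffD2]) (meson less_le_trans)

lemma le_plus_exp: "i \<le> plus_exp i"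
  by (rule strict_mono_imp_increasing[OF strict_mono_plus_exp])

section \<open>The coefficient as a finite signed sum\<close>

definition shifted_alpha :: "nat \<Rightarrow> nat \<Rightarrow> real" where
  "shifted_alpha n m = (if n < m then 0 else alpha a b c (n - m))"

definition pair_coeff :: "nat \<Rightarrow> nat \<Rightarrow> real" where
  "pair_coeff n i = shifted_alpha n (plus_exp i) - shifted_alpha n (minus_exp i)"

text \<open>Any cut-off \<open>M > n\<close> is exact, because both exponents with index
  \<open>i\<close> are at least \<open>i\<close>.\<close>

lemma gamma_coeff_eq_sum:
  assumes "n < M"
  shows "gamma_coeff a b c A B k n = (\<Sum>i<M. (-1) ^ i * pair_coeff n i)"
proof -
  define f where "f j = fps_const ((- 1 :: real) powi (j + k)) * fps_X ^ expo j" for j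
  \<comment> \<open>In the two tails \<open>j + k\<close> equals \<open>2 k + i\<close> and
    \<open>-1 - i\<close>.\<close>
  have sgn: "(-1 :: real) powi (k + int i + k) = (-1) ^ i" "(-1 :: real) powi (- k - 1 - int i + k) = - ((-1) ^ i)" for i
    by (auto simp: power_int_minus_left minus_one_power_iff)
  have f: "f (k + int i) = fps_const ((-1) ^ i) * fps_X ^ plus_exp i"
    "f (- k - 1 - int i) = fps_const (- ((-1) ^ i)) * fps_X ^ minus_exp i" for i
    by (simp_all only: f_def sgn plus_exp_def minus_exp_def)
  have le_minus_exp: "i \<le> minus_exp i" for i
    using le_plus_exp plus_exp_less_minus_exp le_trans less_imp_le by metis
  have "gamma_coeff a b c A B k n = fps_nth (recip_prod a b c * sum_outside (- k) (k - 1) f) n"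
    by (simp add: gamma_coeff_def f_def[abs_def] expo_def)
  also have "\<dots> = fps_nth (recip_prod a b c * ((\<Sum>i<M. f (- k - 1 - int i)) + (\<Sum>i<M. f (k + int i)))) n"
  proof (rule fps_mult_nth_cong)
    fix i assume "i \<le> n"
    then have "i < M" using assms by simp
    then show "fps_nth (sum_outside (- k) (k - 1) f) i =
        fps_nth ((\<Sum>i<M. f (- k - 1 - int i)) + (\<Sum>i<M. f (k + int i))) i"
      using fps_nth_suminf_monomials[of plus_exp i M "\<lambda>i. (-1) ^ i", OF le_plus_exp]
        fps_nth_suminf_monomials[of minus_exp i M "\<lambda>i. - ((-1) ^ i)", OF le_minus_exp]
      unfolding sum_outside_def by (simp add: f)
  qed
  also have "\<dots> = (\<Sum>i<M. fps_nth (recip_prod a b c * (f (- k - 1 - int i) + f (k + int i))) n)"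
    by (simp add: sum.distrib[symmetric] sum_distrib_left fps_sum_nth)
  also have "\<dots> = (\<Sum>i<M. (-1) ^ i * pair_coeff n i)"
  proof (rule sum.cong)
    fix i
    have eq: "recip_prod a b c * (f (- k - 1 - int i) + f (k + int i)) =
        fps_const ((-1) ^ i) * (recip_prod a b c * fps_X ^ plus_exp i)
        - fps_const ((-1) ^ i) * (recip_prod a b c * fps_X ^ minus_exp i)"
      unfolding f by (simp add: algebra_simps fps_const_neg[symmetric] del: fps_const_neg)
    show "fps_nth (recip_prod a b c * (f (- k - 1 - int i) + f (k + int i))) n = (-1) ^ i * pair_coeff n i"
      unfolding eq by (simp add: fps_X_power_mult_right_nth pair_coeff_def shifted_alpha_def alpha_def right_diff_distrib)
  qed simp
  finally show ?thesis .
qed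

lemma gamma_coeff_eq_0:
  assumes "n < plus_exp 0"
  shows "gamma_coeff a b c A B k n = 0"
proof -
  have "pair_coeff n i = 0" for i
  proof -
    have "plus_exp 0 \<le> plus_exp i" using strict_mono_plus_exp by (simp add: strict_mono_less_eq)
    then show ?thesis using assms plus_exp_less_minus_exp[of i] by (simp add: pair_coeff_def shifted_alpha_def)
  qed
  then show ?thesis using gamma_coeff_eq_sum[of n "Suc n"] by simp
qed

text \<open>The first \<open>2 l\<close> pairs are \<open>l\<close> complete blocks with signs
  \<open>+ - - +\<close>, the pairs \<open>2 l\<close> and \<open>2 l + 1\<close> form the block in
  progress, and all later exponents exceed \<open>n\<close>.\<close>

lemma gamma_coeff_eq_block_sum:
  assumes "n < plus_exp (2 * l + 2)"
  shows "gamma_coeff a b c A B k n = (\<Sum>i<2 * l. (-1) ^ i * pair_coeff n i) + pair_coeff n (2 * l) - pair_coeff n (2 * l + 1)"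
proof -
  have "pair_coeff n i = 0" if "2 * l + 2 \<le> i" for i
  proof -
    have "plus_exp (2 * l + 2) \<le> plus_exp i" using strict_mono_plus_exp that by (simp add: strict_mono_less_eq)
    then show ?thesis using assms plus_exp_less_minus_exp[of i] by (simp add: pair_coeff_def shifted_alpha_def)
  qed
  then have "(\<Sum>i<Suc n + (2 * l + 2). (-1) ^ i * pair_coeff n i) = (\<Sum>i<2 * l + 2. (-1) ^ i * pair_coeff n i)"
    by (intro sum.mono_neutral_right) auto
  then show ?thesis
    using gamma_coeff_eq_sum[of n "Suc n + (2 * l + 2)"] by simp
qed

text \<open>
  Main part of the sum over the first \<open>l\<close> complete blocks: with \<open>s\<^sub>1 = \<Sum>\<epsilon> E\<close> and \<open>s\<^sub>2 = \<Sum>\<epsilon> E\<^sup>2\<close> over their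
  signed exponents \<open>\<epsilon> E\<close>, it is \<open>w (s\<^sub>2 - 2 s\<^sub>1 x - s s\<^sub>1)\<close>, as the signs sum to zero.
\<close>
definition block_main :: "real \<Rightarrow> real \<Rightarrow> real" where
  "block_main l x = w * (- (4 * l * (A - B) * x) - 2 * l * (A - B) * s
     + 12 * A * (A - B) * (l * (r + 1)^2 + 2 * (r + 1) * l * (l - 1))
     + 8 * A * (A - B) * (l - 1) * l * (2 * l - 1) + 2 * (A - B)^2 * l)"

lemma block_main_0 [simp]: "block_main 0 x = 0"
  by (simp add: block_main_def)

text \<open>With the value at 0 this verifies the closed form by induction: each step adds one block
  \<open>+ - - +\<close>.\<close>

lemma block_main_step:
  "block_main (l + 1) x = block_main l x + alpha_main (x - qplus (r + 2 * l)) - alpha_main (x - qminus (r + 2 * l + 1))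
     - alpha_main (x - qplus (r + 2 * l + 1)) + alpha_main (x - qminus (r + 2 * l + 2))"
  unfolding block_main_def alpha_main_def qplus_def qminus_def by algebra

text \<open>All \<open>4 l\<close> exponents of the complete blocks are at most \<open>n\<close>, so
  each term is its main part up to an error of at most \<open>D\<close>.\<close>

lemma block_sum_ge:
  assumes "plus_exp (2 * l) \<le> n"
  shows "(\<Sum>i<2 * l. (-1) ^ i * pair_coeff n i) \<ge> block_main (real l) (real n) - 4 * real l * D"
  using assms
proof (induction l)
  case (Suc l)
  have le: "minus_exp (2 * l + 1) \<le> n" "plus_exp (2 * l + 1) \<le> n" "minus_exp (2 * l) \<le> n" "plus_exp (2 * l) \<le> n"
    using Suc.prems plus_exp_less_minus_exp[of "2 * l"] minus_exp_le_plus_exp_Suc[of "2 * l"]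
      plus_exp_less_minus_exp[of "2 * l + 1"] minus_exp_le_plus_exp_Suc[of "2 * l + 1"]
    by simp_all
  have "block_main (real (Suc l)) (real n) = block_main (real l) (real n) + alpha_main (real n - qplus (r + 2 * real l))
      - alpha_main (real n - qminus (r + 2 * real l + 1)) - alpha_main (real n - qplus (r + 2 * real l + 1))
      + alpha_main (real n - qminus (r + 2 * real l + 2))"
    using block_main_step[of "real l" "real n"] by (simp add: add.commute)
  moreover have "shifted_alpha n (plus_exp (2 * l)) \<ge> alpha_main (real n - qplus (r + 2 * real l)) - D"
    using alpha_bounds(1)[OF le(4)] le(4) by (simp add: shifted_alpha_def real_plus_exp)
  moreover have "shifted_alpha n (minus_exp (2 * l)) \<le> alpha_main (real n - qminus (r + 2 * real l + 1)) + D"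
    using alpha_bounds(2)[OF le(3)] le(3) by (simp add: shifted_alpha_def real_minus_exp)
  moreover have "shifted_alpha n (plus_exp (2 * l + 1)) \<le> alpha_main (real n - qplus (r + 2 * real l + 1)) + D"
    using alpha_bounds(2)[OF le(2)] le(2) by (simp add: shifted_alpha_def real_plus_exp add_ac)
  moreover have "shifted_alpha n (minus_exp (2 * l + 1)) \<ge> alpha_main (real n - qminus (r + 2 * real l + 2)) - D"
    using alpha_bounds(1)[OF le(1)] le(1) by (simp add: shifted_alpha_def real_minus_exp add_ac)
  moreover have "(\<Sum>i<2 * Suc l. (-1) ^ i * pair_coeff n i) = (\<Sum>i<2 * l. (-1) ^ i * pair_coeff n i)
      + shifted_alpha n (plus_exp (2 * l)) - shifted_alpha n (minus_exp (2 * l))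
      - shifted_alpha n (plus_exp (2 * l + 1)) + shifted_alpha n (minus_exp (2 * l + 1))"
    by (simp add: pair_coeff_def)
  ultimately show ?case using Suc.IH[OF le(4)] by (simp add: algebra_simps)
qed simp

section \<open>Estimates with one to four terms of the last block\<close>

definition G1 where
  "G1 l = 4 * w * (A - B) * (2 * A * r - A - B) * l^2
     + 2 * w * (2 * r + 1) * (A - B) * (2 * A * r - A - B) * l - w * s^2 / 4 - (4 * l + 1) * D"
definition G2 where
  "G2 l = 8 * w * (A - B) * (A * r - B) * l^2
     + 2 * w * (A - B) * (4 * A * r^2 + 4 * A * r - 6 * B * r + A - 3 * B + s) * l
     + w * (2 * r + 1) * (A - B) * (2 * A * r - 2 * B * r + A - B + s) - (4 * l + 2) * D"
definition G3 where
  "G3 l = 8 * w * (A - B) * (A * r + B) * l^2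
     + 2 * w * (A - B) * (4 * A * r^2 + 4 * A * r + 6 * B * r + A + 5 * B + s) * l
     + w * (2 * r + 1) * (A - B) * (2 * A * r + 2 * B * r + A + 3 * B + s) - (4 * l + 3) * D"
definition G4 where
  "G4 l = 8 * w * (A - B) * (A * r + B) * l^2
     + 2 * w * (A - B) * (4 * A * r^2 + 8 * A * r + 2 * B * r - A + 7 * B - s) * l
     + 2 * w * (A - B) * (4 * A * r^2 + 4 * A * r + 2 * B * r - A + 3 * B - s) - (4 * l + 3) * D"
definition G5 where
  "G5 l = 8 * w * (A - B) * (A * r - B) * l^2
     + 2 * w * (A - B) * (4 * A * r^2 + 8 * A * r - 2 * B * r - A - 9 * B - s) * l
     + 2 * w * (A - B) * (4 * A * r^2 + 4 * A * r - 2 * B * r - A - 5 * B - s) - (4 * l + 4) * D"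

text \<open>The signs sum to 1, so the main part is convex in \<open>x\<close>; completing the
  square leaves the value at the vertex.\<close>

lemma partial_block1_ge:
  "block_main l x + alpha_main (x - qplus (r + 2 * l)) - (4 * l + 1) * D \<ge> G1 l"
proof -
  \<comment> \<open>Half of \<open>s\<close> keeps fractions out of the completed square.\<close>
  define t where "t = s / 2"
  have s: "s = 2 * t" by (simp add: t_def)
  have G1: "G1 l = 4 * w * (A - B) * (2 * A * r - A - B) * l^2
     + 2 * w * (2 * r + 1) * (A - B) * (2 * A * r - A - B) * l - w * t^2 - (4 * l + 1) * D"
    by (simp add: G1_def t_def power_divide)
  have "block_main l x + alpha_main (x - qplus (r + 2 * l)) - (4 * l + 1) * D =
     G1 l + w * (x - 2 * l * (A - B) - qplus (r + 2 * l) + t)^2"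
    unfolding block_main_def alpha_main_def qplus_def G1 s by algebra
  then show ?thesis using w_pos by simp
qed

text \<open>The signs sum to 0, so the main part is linear in \<open>x\<close>; its slope
  \<open>2 w (A - B) (2 r + 2 l + 1)\<close> is positive, and the minimum lies at the left
  end.\<close>

lemma partial_block2_ge:
  assumes "qminus (r + 2 * l + 1) \<le> x" "l \<ge> 0"
  shows "block_main l x + alpha_main (x - qplus (r + 2 * l))
     - alpha_main (x - qminus (r + 2 * l + 1)) - (4 * l + 2) * D \<ge> G2 l"
proof -
  have "block_main l x + alpha_main (x - qplus (r + 2 * l)) - alpha_main (x - qminus (r + 2 * l + 1)) - (4 * l + 2) * D =
     G2 l + 2 * w * (A - B) * (2 * r + 2 * l + 1) * (x - qminus (r + 2 * l + 1))"
    unfolding block_main_def alpha_main_def qplus_def qminus_def G2_def by algebra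
  then show ?thesis using w_pos AB r_ge_1 assms by simp
qed

text \<open>The signs sum to -1, so the main part is concave in \<open>x\<close> with leading
  coefficient \<open>-w\<close>; \<open>G3\<close> and \<open>G4\<close> are its values at the two
  ends.\<close>

lemma partial_block3_ge:
  fixes l x :: real
  assumes "qplus (r + 2 * l + 1) \<le> x" "x < qminus (r + 2 * l + 2)" "G3 l \<ge> 0" "G4 l \<ge> 0"
  shows "block_main l x + alpha_main (x - qplus (r + 2 * l)) - alpha_main (x - qminus (r + 2 * l + 1))
     - alpha_main (x - qplus (r + 2 * l + 1)) - (4 * l + 3) * D \<ge> 0"
proof -
  define q where "q x = block_main l x + alpha_main (x - qplus (r + 2 * l)) - alpha_main (x - qminus (r + 2 * l + 1))
     - alpha_main (x - qplus (r + 2 * l + 1)) - (4 * l + 3) * D" for x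
  \<comment> \<open>The lower coefficients are interpolated from the values at 0 and 1.\<close>
  have q: "q x = - (w * x^2) + (q 1 + w - q 0) * x + q 0" for x
    unfolding q_def block_main_def alpha_main_def by algebra
  have q3: "q (qplus (r + 2 * l + 1)) = G3 l"
    unfolding q_def block_main_def alpha_main_def qplus_def qminus_def G3_def by (simp add: algebra_simps power2_eq_square)
  have q4: "q (qminus (r + 2 * l + 2)) = G4 l"
    unfolding q_def block_main_def alpha_main_def qplus_def qminus_def G4_def by (simp add: algebra_simps power2_eq_square)
  have "q x \<ge> 0"
    by (rule concave_quadratic_ge[OF q _ assms(1,2)]) (use w_pos assms(3,4) q3 q4 in simp_all)
  then show ?thesis by (simp add: q_def)
qed

text \<open>The signs sum to 0 again, now with negative slope \<open>-4 w (l + 1) (A - B)\<close>,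
  so the minimum lies at the right end.\<close>

lemma partial_block4_ge:
  assumes "x \<le> qplus (r + 2 * l + 2)" "l \<ge> 0"
  shows "block_main l x + alpha_main (x - qplus (r + 2 * l)) - alpha_main (x - qminus (r + 2 * l + 1))
     - alpha_main (x - qplus (r + 2 * l + 1)) + alpha_main (x - qminus (r + 2 * l + 2)) - (4 * l + 4) * D \<ge> G5 l"
proof -
  have "block_main l x + alpha_main (x - qplus (r + 2 * l)) - alpha_main (x - qminus (r + 2 * l + 1))
     - alpha_main (x - qplus (r + 2 * l + 1)) + alpha_main (x - qminus (r + 2 * l + 2)) - (4 * l + 4) * D =
     G5 l + 4 * w * (l + 1) * (A - B) * (qplus (r + 2 * l + 2) - x)"
    unfolding block_main_def alpha_main_def qplus_def qminus_def G5_def by algebra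
  then show ?thesis using w_pos AB assms by simp
qed

text \<open>The cases count the exponents of the block in progress that are at most
  \<open>n\<close>. For \<open>l = 0\<close> with a single term, nonnegativity of
  \<open>alpha\<close> takes the place of \<open>G1\<close>.\<close>

lemma gamma_coeff_nonneg_block:
  fixes l n :: nat
  assumes n: "plus_exp (2 * l) \<le> n" "n < plus_exp (2 * l + 2)"
    and G1: "l = 0 \<or> G1 l \<ge> 0" and G: "G2 l \<ge> 0" "G3 l \<ge> 0" "G4 l \<ge> 0" "G5 l \<ge> 0"
  shows "gamma_coeff a b c A B k n \<ge> 0"
proof -
  define S where "S = (\<Sum>i<2 * l. (-1) ^ i * pair_coeff n i)"
  define x where "x = real n"
  have S: "S \<ge> block_main (real l) x - 4 * real l * D"
    unfolding S_def x_def by (rule block_sum_ge[OF n(1)])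
  have gamma: "gamma_coeff a b c A B k n =
      S + shifted_alpha n (plus_exp (2 * l)) - shifted_alpha n (minus_exp (2 * l))
      - shifted_alpha n (plus_exp (2 * l + 1)) + shifted_alpha n (minus_exp (2 * l + 1))"
    using gamma_coeff_eq_block_sum[OF n(2)] by (simp add: S_def pair_coeff_def)
  have real: "real (plus_exp (2 * l)) = qplus (r + 2 * real l)" "real (minus_exp (2 * l)) = qminus (r + 2 * real l + 1)"
    "real (plus_exp (2 * l + 1)) = qplus (r + 2 * real l + 1)" "real (minus_exp (2 * l + 1)) = qminus (r + 2 * real l + 2)"
    "real (plus_exp (2 * l + 2)) = qplus (r + 2 * real l + 2)"
    by (simp_all add: real_plus_exp real_minus_exp add_ac)
  have order: "plus_exp (2 * l) < minus_exp (2 * l)" "minus_exp (2 * l) \<le> plus_exp (2 * l + 1)"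
    "plus_exp (2 * l + 1) < minus_exp (2 * l + 1)" "minus_exp (2 * l + 1) \<le> plus_exp (2 * l + 2)"
    using plus_exp_less_minus_exp[of "2 * l"] minus_exp_le_plus_exp_Suc[of "2 * l"]
      plus_exp_less_minus_exp[of "2 * l + 1"] minus_exp_le_plus_exp_Suc[of "2 * l + 1"]
    by simp_all
  have lower: "shifted_alpha n m \<ge> alpha_main (x - real m) - D" if "m \<le> n" for m
    using alpha_bounds(1)[OF that] that by (simp add: shifted_alpha_def x_def)
  have upper: "shifted_alpha n m \<le> alpha_main (x - real m) + D" if "m \<le> n" for m
    using alpha_bounds(2)[OF that] that by (simp add: shifted_alpha_def x_def)
  have zero: "shifted_alpha n m = 0" if "n < m" for m using that by (simp add: shifted_alpha_def)
  consider "n < minus_exp (2 * l)" | "minus_exp (2 * l) \<le> n" "n < plus_exp (2 * l + 1)"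
    | "plus_exp (2 * l + 1) \<le> n" "n < minus_exp (2 * l + 1)" | "minus_exp (2 * l + 1) \<le> n"
    by linarith
  then show ?thesis
  proof cases
    case 1
    have g: "gamma_coeff a b c A B k n = S + shifted_alpha n (plus_exp (2 * l))"
      using 1 order by (simp add: gamma zero)
    show ?thesis
    proof (cases "l = 0")
      case True
      then show ?thesis using g alpha_nonneg[OF pos] by (simp add: S_def shifted_alpha_def)
    next
      case False
      then have "0 \<le> block_main (real l) x + alpha_main (x - qplus (r + 2 * real l)) - (4 * real l + 1) * D"
        using G1 partial_block1_ge[of l x] by linarith
      then show ?thesis
        using g S lower[OF n(1), unfolded real] by (simp add: algebra_simps)
    qed
  next
    case 2
    have "gamma_coeff a b c A B k n = S + shifted_alpha n (plus_exp (2 * l)) - shifted_alpha n (minus_exp (2 * l))"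
      using 2 order by (simp add: gamma zero)
    moreover have "0 \<le> block_main (real l) x + alpha_main (x - qplus (r + 2 * real l))
        - alpha_main (x - qminus (r + 2 * real l + 1)) - (4 * real l + 2) * D"
      using G partial_block2_ge[of l x] 2 by (simp add: real[symmetric] x_def)
    ultimately show ?thesis
      using S lower[OF n(1), unfolded real] upper[OF 2(1), unfolded real] by (simp add: algebra_simps)
  next
    case 3
    have "gamma_coeff a b c A B k n = S + shifted_alpha n (plus_exp (2 * l)) - shifted_alpha n (minus_exp (2 * l))
      - shifted_alpha n (plus_exp (2 * l + 1))"
      using 3 order by (simp add: gamma zero)
    moreover have "0 \<le> block_main (real l) x + alpha_main (x - qplus (r + 2 * real l))
        - alpha_main (x - qminus (r + 2 * real l + 1))
        - alpha_main (x - qplus (r + 2 * real l + 1)) - (4 * real l + 3) * D"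
      using G 3 by (intro partial_block3_ge) (simp_all add: real[symmetric] x_def)
    ultimately show ?thesis
      using S lower[OF n(1), unfolded real] upper[of "minus_exp (2 * l)", unfolded real]
        upper[OF 3(1), unfolded real] order 3
      by (simp add: algebra_simps)
  next
    case 4
    have "0 \<le> block_main (real l) x + alpha_main (x - qplus (r + 2 * real l))
        - alpha_main (x - qminus (r + 2 * real l + 1))
        - alpha_main (x - qplus (r + 2 * real l + 1)) + alpha_main (x - qminus (r + 2 * real l + 2)) - (4 * real l + 4) * D"
      using G partial_block4_ge[of x l] n by (simp add: real[symmetric] x_def)
    then show ?thesis
      unfolding gamma
      using S lower[OF n(1), unfolded real] upper[of "minus_exp (2 * l)", unfolded real]
        upper[of "plus_exp (2 * l + 1)", unfolded real] lower[OF 4, unfolded real] order 4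
      by (simp add: algebra_simps)
  qed
qed

section \<open>From blocks to both parts of the theorem\<close>

lemma gamma_coeff_nonneg_from_block:
  assumes n: "plus_exp (2 * L) \<le> n"
    and G: "\<And>l. L \<le> l \<Longrightarrow> (l = 0 \<or> G1 (real l) \<ge> 0)
      \<and> G2 (real l) \<ge> 0 \<and> G3 (real l) \<ge> 0 \<and> G4 (real l) \<ge> 0 \<and> G5 (real l) \<ge> 0"
  shows "gamma_coeff a b c A B k n \<ge> 0"
proof -
  \<comment> \<open>This is the block containing \<open>n\<close>. Monotonicity forces
    \<open>L \<le> l\<close>; the lower end comes from minimality if \<open>l > L\<close>, and from
    the hypothesis on \<open>n\<close> if \<open>l = L\<close>.\<close>
  define l where "l = (LEAST l. n < plus_exp (2 * l + 2))"
  have "n < plus_exp (2 * n + 2)" using le_plus_exp[of "2 * n + 2"] by simp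
  then have l: "n < plus_exp (2 * l + 2)" unfolding l_def by (rule LeastI)
  have "2 * L < 2 * l + 2"
    using n l strict_mono_less[OF strict_mono_plus_exp, of "2 * L" "2 * l + 2"] by linarith
  then have Ll: "L \<le> l" by simp
  have "plus_exp (2 * l) \<le> n"
  proof (cases "l = L")
    case False
    then have "\<not> n < plus_exp (2 * (l - 1) + 2)"
      unfolding l_def using Ll by (intro not_less_Least) (simp add: l_def)
    moreover have "2 * (l - 1) + 2 = 2 * l" using False Ll by simp
    ultimately show ?thesis by simp
  qed (use n in simp)
  then show ?thesis
    using l G[OF Ll] by (intro gamma_coeff_nonneg_block[of l]) auto
qed

text \<open>Makes the leading coefficients of the members of \<open>G_quadratics\<close> positive;
  all three follow from \<open>A r \<ge> A > B\<close>.\<close>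

lemma leading_factors_pos: "2 * A * r - A - B > 0" "A * r - B > 0" "A * r + B > 0"
proof -
  have "A \<le> A * r" using AB r_ge_1 by simp
  then show "2 * A * r - A - B > 0" "A * r - B > 0" "A * r + B > 0" using AB by linarith+
qed

text \<open>With \<open>L\<close> equal to \<open>L_bound\<close>, every block index from
  \<open>L\<close> on lies beyond all the \<open>R_op\<close> values, and
  \<open>plus_exp (2 * L)\<close> is exactly \<open>N_bound\<close>.\<close>

lemma gamma_coeff_nonneg_of_ge_N_bound:
  assumes "real n \<ge> N_bound a b c A B k"
  shows "gamma_coeff a b c A B k n \<ge> 0"
proof -
  define Gs where "Gs = G_quadratics a b c A B k"
  define L where "L = nat (L_bound a b c A B k)"
  have fin: "finite Gs" "Gs \<noteq> {}"
    by (simp_all add: Gs_def G_quadratics_def Let_def)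
  have T1: "T_op Gs \<ge> 1" using fin by (rule T_op_ge_1)
  then have Lint: "real_of_int (L_bound a b c A B k) = real L"
    by (simp add: L_def L_bound_def Gs_def)
  have "T_op Gs \<le> real_of_int (L_bound a b c A B k)"
    unfolding L_bound_def Gs_def by (rule le_of_int_ceiling)
  then have L: "T_op Gs \<le> real L" using Lint by simp
  have lead: "\<forall>G\<in>Gs. degree G \<le> 2 \<and> coeff G 2 > 0"
    using AB leading_factors_pos p_pos
    unfolding Gs_def G_quadratics_def Let_def quad_def p_def[symmetric] r_def[symmetric]
    by (simp add: numeral_2_eq_2)
  \<comment> \<open>The final \<open>True\<close> stands for the empty rest of the finite set, so
    that the conjuncts correspond one by one.\<close>
  have nonneg: "G1 x \<ge> 0 \<and> G2 x \<ge> 0 \<and> G3 x \<ge> 0 \<and> G4 x \<ge> 0 \<and> G5 x \<ge> 0 \<and> True" if "x \<ge> T_op Gs" for x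
    using poly_nonneg_of_ge_T_op[OF fin(1) that lead]
    unfolding Gs_def G_quadratics_def Let_def p_def[symmetric] r_def[symmetric] s_def[symmetric]
      D_def[symmetric] quad_def divide_p ball_simps(5,7)
    by (elim conj_forward)
      (rule TrueI | erule order.trans, rule eq_refl,
        simp add: G1_def G2_def G3_def G4_def G5_def power2_eq_square field_simps)+
  have "real (plus_exp (2 * L)) = N_bound a b c A B k"
    by (simp add: real_plus_exp qplus_def N_bound_def Let_def Lint r_def)
  then have "plus_exp (2 * L) \<le> n" using assms by simp
  then show ?thesis
    using nonneg L by (intro gamma_coeff_nonneg_from_block[of L]) auto
qed

text \<open>\<open>H_1\<close> to \<open>H_4\<close> settle the block \<open>l = 0\<close>. Values
  and \<open>l\<close>-derivatives at 1, obtained from the further \<open>H_i\<close>, carry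
  nonnegativity to all \<open>l \<ge> 1\<close>.\<close>

lemma gamma_coeff_nonneg_of_ge_K_bound:
  assumes "k \<ge> K_bound a b c A B"
  shows "gamma_coeff a b c A B k n \<ge> 0"
proof -
  define Hs where "Hs = H_quadratics a b c A B"
  have fin: "finite Hs" by (simp add: Hs_def H_quadratics_def Let_def)
  have lead: "\<forall>G\<in>Hs. degree G \<le> 2 \<and> coeff G 2 > 0"
    using AB p_pos
    unfolding Hs_def H_quadratics_def Let_def quad_def p_def[symmetric]
    by (simp add: numeral_2_eq_2)
  have "T_op Hs \<le> r"
    using assms by (simp add: K_bound_def Hs_def r_def ceiling_le_iff)
  from poly_nonneg_of_ge_T_op[OF fin this lead]
  text \<open>One conjunct per \<open>H\<^sub>i\<close>, in order; \<open>H\<^sub>1\<^sub>0\<close> is dropped.\<close>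
  have H: "G2 0 \<ge> 0 \<and> G3 0 \<ge> 0 \<and> G4 0 \<ge> 0 \<and> G5 0 \<ge> 0 \<and> G1 1 \<ge> 0
      \<and> 2 * w * (A - B) * (4 * A * r^2 + 12 * A * r - 6 * B * r + A - 11 * B + s) - 4 * D \<ge> 0
      \<and> G2 1 \<ge> 0
      \<and> 2 * w * (A - B) * (4 * A * r^2 + 12 * A * r + 6 * B * r + A + 13 * B + s) - 4 * D \<ge> 0
      \<and> G3 1 \<ge> 0 \<and> True \<and> G4 1 \<ge> 0
      \<and> 2 * w * (A - B) * (4 * A * r^2 + 16 * A * r - 2 * B * r - A - 17 * B - s) - 4 * D \<ge> 0
      \<and> G5 1 \<ge> 0 \<and> True"
    unfolding Hs_def H_quadratics_def Let_def p_def[symmetric] s_def[symmetric] D_def[symmetric]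
      quad_def divide_p ball_simps(5,7)
    by (elim conj_forward)
      (rule TrueI | erule order.trans, rule eq_refl,
        simp add: G1_def G2_def G3_def G4_def G5_def power2_eq_square field_simps)+
  have base: "G2 0 \<ge> 0" "G3 0 \<ge> 0" "G4 0 \<ge> 0" "G5 0 \<ge> 0"
      "G1 1 \<ge> 0" "G2 1 \<ge> 0" "G3 1 \<ge> 0" "G4 1 \<ge> 0" "G5 1 \<ge> 0"
    and deriv: "2 * w * (A - B) * (4 * A * r^2 + 12 * A * r - 6 * B * r + A - 11 * B + s) - 4 * D \<ge> 0"
      "2 * w * (A - B) * (4 * A * r^2 + 12 * A * r + 6 * B * r + A + 13 * B + s) - 4 * D \<ge> 0"
      "2 * w * (A - B) * (4 * A * r^2 + 16 * A * r - 2 * B * r - A - 17 * B - s) - 4 * D \<ge> 0"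
    using H by blast+
  have G: "G1 x \<ge> 0 \<and> G2 x \<ge> 0 \<and> G3 x \<ge> 0 \<and> G4 x \<ge> 0 \<and> G5 x \<ge> 0" if x: "x \<ge> 1" for x
  proof (intro conjI)
    define Z where "Z = w * (A - B) * (2 * A * r - A - B)"
    have Z: "Z > 0" using w_pos AB leading_factors_pos by (simp add: Z_def)
    have ws: "w * s^2 / 4 \<ge> 0" using w_pos by simp
    have G1: "G1 x = 4 * Z * x^2 + (2 * (2 * r + 1) * Z - 4 * D) * x + (- (w * s^2 / 4) - D)" for x
      by (simp add: G1_def Z_def algebra_simps)
    \<comment> \<open>The derivative at 1 needs no separate condition: it exceeds the value at 1 by
      \<open>4 Z + w s^2 / 4 + D \<ge> 0\<close>.\<close>
    show "G1 x \<ge> 0"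
      unfolding G1
    proof (rule quadratic_nonneg_right_of_1[OF _ _ _ x])
      show "4 * Z + (2 * (2 * r + 1) * Z - 4 * D) + (- (w * s^2 / 4) - D) \<ge> 0"
        using base(5) by (simp add: G1)
      then show "2 * (4 * Z) + (2 * (2 * r + 1) * Z - 4 * D) \<ge> 0"
        using ws Z D_nonneg by linarith
    qed (use Z in simp)
    define u where "u = 8 * w * (A - B) * (A * r - B)"
    define v where "v = 8 * w * (A - B) * (A * r + B)"
    have uv: "u \<ge> 0" "v \<ge> 0" using w_pos AB leading_factors_pos by (simp_all add: u_def v_def)
    define g2 where "g2 = 2 * w * (A - B) * (4 * A * r^2 + 4 * A * r - 6 * B * r + A - 3 * B + s)"
    have G2: "G2 x = u * x^2 + (g2 - 4 * D) * x + (G2 0)" for x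
      by (simp add: G2_def u_def g2_def algebra_simps)
    show "G2 x \<ge> 0"
      unfolding G2[of x]
      using base(6) deriv(1) uv
      by (intro quadratic_nonneg_right_of_1[OF _ _ _ x])
        (simp_all add: G2[of 1], simp add: u_def g2_def algebra_simps)
    define g3 where "g3 = 2 * w * (A - B) * (4 * A * r^2 + 4 * A * r + 6 * B * r + A + 5 * B + s)"
    have G3: "G3 x = v * x^2 + (g3 - 4 * D) * x + (G3 0)" for x
      by (simp add: G3_def v_def g3_def algebra_simps)
    show "G3 x \<ge> 0"
      unfolding G3[of x]
      using base(7) deriv(2) uv
      by (intro quadratic_nonneg_right_of_1[OF _ _ _ x])
        (simp_all add: G3[of 1], simp add: v_def g3_def algebra_simps)
    define g5 where "g5 = 2 * w * (A - B) * (4 * A * r^2 + 8 * A * r - 2 * B * r - A - 9 * B - s)"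
    have G5: "G5 x = u * x^2 + (g5 - 4 * D) * x + (G5 0)" for x
      by (simp add: G5_def u_def g5_def algebra_simps)
    have G5': "2 * u + (g5 - 4 * D) \<ge> 0"
      using deriv(3) by (simp add: u_def g5_def algebra_simps)
    show "G5 x \<ge> 0"
      unfolding G5[of x]
      using base(9) G5' uv by (intro quadratic_nonneg_right_of_1[OF _ _ _ x]) (simp_all add: G5[of 1])
    text \<open>
      The constant term of \<open>H\<^sub>1\<^sub>0\<close> has the opposite sign to that of the derivative of \<open>G\<^sub>4\<close> at
      \<open>l = 1\<close>; but this derivative is at least that of \<open>G\<^sub>5\<close>, which is \<open>H\<^sub>1\<^sub>2\<close>.
    \<close>
    define g4 where "g4 = 2 * w * (A - B) * (4 * A * r^2 + 8 * A * r + 2 * B * r - A + 7 * B - s)"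
    have G4: "G4 x = v * x^2 + (g4 - 4 * D) * x + (G4 0)" for x
      by (simp add: G4_def v_def g4_def algebra_simps)
    have "2 * v + g4 - (2 * u + g5) = 2 * w * (A - B) * (4 * B * r + 32 * B)"
      by (simp add: u_def v_def g4_def g5_def algebra_simps)
    also have "\<dots> \<ge> 0" using w_pos AB r_ge_1 by simp
    finally have G4': "2 * v + (g4 - 4 * D) \<ge> 0" using G5' by simp
    show "G4 x \<ge> 0"
      unfolding G4[of x]
      using base(8) G4' uv by (intro quadratic_nonneg_right_of_1[OF _ _ _ x]) (simp_all add: G4[of 1])
  qed
  show ?thesis
  proof (cases "plus_exp 0 \<le> n")
    case True
    have "(l = 0 \<or> G1 (real l) \<ge> 0) \<and> G2 (real l) \<ge> 0 \<and> G3 (real l) \<ge> 0 \<and> G4 (real l) \<ge> 0 \<and> G5 (real l) \<ge> 0" for l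
      using base(1-4) G[of "real l"] by (cases "l = 0") auto
    then show ?thesis using True by (intro gamma_coeff_nonneg_from_block[of 0]) auto
  qed (simp add: gamma_coeff_eq_0)
qed

end

theorem theorem2p2:
  fixes A B :: real and a b c :: nat
  assumes "A > B" and "B \<ge> 0"
    and "integer_valued [:0, B, A:]"
    and "a > 0" and "b > 0" and "c > 0"
    and "a \<noteq> b" and "a \<noteq> c" and "b \<noteq> c"
    and "coprime a b" and "coprime a c" and "coprime b c"
  shows "(\<forall>(n::nat) (k::int). k \<ge> 1 \<and> k \<ge> K_bound a b c A B \<longrightarrow> gamma_coeff a b c A B k n \<ge> 0) \<and>
         (\<forall>(k::int) (n::nat). k \<ge> 1 \<and> real n \<ge> N_bound a b c A B k \<longrightarrow> gamma_coeff a b c A B k n \<ge> 0)"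
proof -
  have "truncated_series A B a b c k" if "k \<ge> 1" for k
    using assms that by unfold_locales
  then show ?thesis
    using truncated_series.gamma_coeff_nonneg_of_ge_K_bound
      truncated_series.gamma_coeff_nonneg_of_ge_N_bound by blast
qed

end
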